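(* Let $n\ge2$ and for $b=0,\dots,n-1$ let $(D_b,v_b)$ be a cyclic graded finite-dimensional $\mathfrak{sl}_n(\mathcal O)$-module satisfying the conditions (1)--(3) of the context, with $D_b$ $b$-admissible for $b=1,\dots,n-1$. Then the module $\mathbf D(0)\subset\bigotimes_{b=0}^{n-1}D_b$ admits a natural action of the Iwahori algebra: it is stable under the Lie algebra $\mathfrak a(0)\subset\bigoplus_b\mathfrak{gl}_n(\mathcal O)$, which is isomorphic to the Iwahori algebra $\{A\in\mathfrak{gl}_n(\mathcal O):A|_{z=0}\text{ is upper triangular}\}$.
   Context: $\mathcal O=\mathbb C[[z]]$; $\mathfrak{sl}_n=\mathfrak n_-\oplus\mathfrak h\oplus\mathfrak n$ (strictly lower triangular, diagonal, strictly upper triangular); $E_{i,j}$ matrix units. Modules: $D$ is a finite-dimensional module over $\mathfrak{sl}_n(\mathcal O)$, graded compatibly with the $z$-grading (so $\mathfrak{sl}_n\otimes z^N\mathcal O$ acts by $0$ for $N$ large), with cyclic vector $v$ such that: (1) $v$ is an $\mathfrak h$-weight vector; (2) $\mathfrak n_-[z]v=0$ and $z\mathfrak h[z]v=0$; (3) $\mathrm U(\mathfrak n[z])v=D$. It is regarded as a $\mathfrak{gl}_n(\mathcal O)$-module by letting scalar matrices act by $0$. $b$-admissibility ($1\le b\le n-1$): for $\varepsilon\ne0$ let $\mathrm{sh}_b:\mathfrak n(\mathcal O)\to\mathfrak n(\mathcal O)$ be the $\mathcal O$-linear Lie algebra endomorphism with $\mathrm{sh}_b(E_{i,j})=(z+\varepsilon)E_{i,j}$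 if $i\le b<j$ and $\mathrm{sh}_b(E_{i,j})=E_{i,j}$ otherwise ($i<j$). $D$ is $b$-admissible if for every $\varepsilon\ne0$ there is a linear isomorphism $f:D\to D$ with $f(v)=v$ and $f\circ x=\mathrm{sh}_b(x)\circ f$ for all $x\in\mathfrak n(\mathcal O)$. $\mathfrak a(\varepsilon)\subset\bigoplus_{b=0}^{n-1}\mathfrak{gl}_n(\mathcal O)$ is the Lie algebra which is the $\mathcal O$-span of the tuples $(x_b)_b$: (i) $x_b=E_{i,i}$ for all $b$; (ii) for $1\le i<j\le n$: $x_b=(z+\varepsilon)E_{i,j}$ if $i\le b<j$, $x_b=E_{i,j}$ otherwise; (iii) for $1\le i<j\le n$: $x_b=E_{j,i}$ if $i\le b<j$, $x_b=(z+\varepsilon)E_{j,i}$ otherwise. It acts on $T=\bigotimes_bD_b$, the $b$-th component acting on the $b$-th factor. $\mathbf D(0)$: treat $\varepsilon$ as a formal variable, let $M\subset T[\varepsilon]$ be the $\mathbb C[\varepsilon]$-submodule generated from $\bigotimes_bv_b$ by the operators of $\mathfrak a(\varepsilon)$, and put $\mathbf D(0)=\{(\varepsilon^{-r}p)|_{\varepsilon=0}:r\ge0,\ p\in M\cap\varepsilon^rT[\varepsilon]\}\subset T$ (the limit as $\varepsilon\to0$ of $\mathrm U(\mathfrak a(\varepsilon)).\bigotimes_bv_b$). *)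

theory Defs
  imports
    "Jordan_Normal_Form.Matrix"
    "HOL-Computational_Algebra.Polynomial_FPS"
    "HOL-Library.Function_Algebras"
begin

text \<open>
  The ring \<open>\<O> = \<complex>[[z]]\<close> is \<^typ>\<open>complex fps\<close>, with \<open>z\<close> being \<^term>\<open>fps_X\<close>.
  Matrix positions are numbered from \<open>0\<close>, as usual for \<^typ>\<open>'a mat\<close>; the indices \<open>b = 0,\<dots>,n-1\<close>
  of the modules keep their meaning.

  All modules \<open>D\<^sub>b\<close> are subspaces of one ambient complex vector space \<open>'v\<close> with scalar
  multiplication \<open>s\<close>.  This is no restriction: \<open>'v\<close> is arbitrary, and any finite family of
  vector spaces embeds in its direct sum.
\<close>


subsection \<open>Lie algebras of matrices and their modules\<close>

definition lie_br :: "'r::comm_ring_1 mat \<Rightarrow> 'r mat \<Rightarrow> 'r mat" where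
  "lie_br A B = A * B - B * A"

definition mat_tr :: "'r::comm_ring_1 mat \<Rightarrow> 'r" where
  "mat_tr A = (\<Sum>i<dim_row A. A $$ (i, i))"

definition sl :: "nat \<Rightarrow> 'r::comm_ring_1 mat set" where
  "sl n = {A \<in> carrier_mat n n. mat_tr A = 0}"

definition nil_plus :: "nat \<Rightarrow> 'r::comm_ring_1 mat set" where
  "nil_plus n = {A \<in> carrier_mat n n. \<forall>i<n. \<forall>j<n. j \<le> i \<longrightarrow> A $$ (i, j) = 0}"

definition nil_minus :: "nat \<Rightarrow> 'r::comm_ring_1 mat set" where
  "nil_minus n = {A \<in> carrier_mat n n. \<forall>i<n. \<forall>j<n. i \<le> j \<longrightarrow> A $$ (i, j) = 0}"

definition cartan :: "nat \<Rightarrow> 'r::comm_ring_1 mat set" where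
  "cartan n = {A \<in> sl n. diagonal_mat A}"

text \<open>Intersecting with the following set turns \<open>\<g>(\<O>)\<close> into \<open>\<g>[z]\<close>.\<close>

definition poly_mats :: "complex fps mat set" where
  "poly_mats = {A. \<forall>i<dim_row A. \<forall>j<dim_col A. \<exists>p. A $$ (i, j) = fps_of_poly p}"

abbreviation const_mat :: "complex mat \<Rightarrow> complex fps mat" where
  "const_mat A \<equiv> map_mat fps_const A"

definition iwahori :: "nat \<Rightarrow> complex fps mat set" where
  "iwahori n = {A \<in> carrier_mat n n. upper_triangular (map_mat (\<lambda>f. fps_nth f 0) A)}"

definition lie_module ::
  "complex fps mat set \<Rightarrow> (complex \<Rightarrow> 'v::ab_group_add \<Rightarrow> 'v) \<Rightarrow> 'v set
    \<Rightarrow> (complex fps mat \<Rightarrow> 'v \<Rightarrow> 'v) \<Rightarrow> bool" where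
  "lie_module L s V \<rho> \<longleftrightarrow>
     module.subspace s V \<and>
     (\<forall>x\<in>L. \<forall>v\<in>V. \<rho> x v \<in> V) \<and>
     (\<forall>x\<in>L. \<forall>u\<in>V. \<forall>v\<in>V. \<rho> x (u + v) = \<rho> x u + \<rho> x v) \<and>
     (\<forall>x\<in>L. \<forall>v\<in>V. \<forall>c. \<rho> x (s c v) = s c (\<rho> x v)) \<and>
     (\<forall>x\<in>L. \<forall>y\<in>L. \<forall>v\<in>V. \<rho> (x + y) v = \<rho> x v + \<rho> y v) \<and>
     (\<forall>x\<in>L. \<forall>v\<in>V. \<forall>c. \<rho> (fps_const c \<cdot>\<^sub>m x) v = s c (\<rho> x v)) \<and>
     (\<forall>x\<in>L. \<forall>y\<in>L. \<forall>v\<in>V. \<rho> (lie_br x y) v = \<rho> x (\<rho> y v) - \<rho> y (\<rho> x v))"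


subsection \<open>Cyclic graded modules and admissibility\<close>

text \<open>
  A grading by integers.  The last clause is the boundedness that compatibility with the grading
  means for power series with infinitely many nonzero coefficients.
\<close>

definition graded_module ::
  "nat \<Rightarrow> (complex \<Rightarrow> 'v::ab_group_add \<Rightarrow> 'v) \<Rightarrow> 'v set \<Rightarrow> (complex fps mat \<Rightarrow> 'v \<Rightarrow> 'v) \<Rightarrow> bool" where
  "graded_module n s D \<rho> \<longleftrightarrow>
     (\<exists>G :: int \<Rightarrow> 'v set.
        (\<forall>k. module.subspace s (G k) \<and> G k \<subseteq> D) \<and>
        (\<forall>d\<in>D. \<exists>!g. (\<forall>k. g k \<in> G k) \<and> finite {k. g k \<noteq> 0} \<and> d = (\<Sum>k | g k \<noteq> 0. g k)) \<and>
        (\<forall>x\<in>sl n. \<forall>i k. \<forall>d\<in>G k. \<rho> (fps_X ^ i \<cdot>\<^sub>m const_mat x) d \<in> G (k + int i))) \<and>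
     (\<exists>N. \<forall>x\<in>sl n. \<forall>d\<in>D. \<rho> (fps_X ^ N \<cdot>\<^sub>m x) d = 0)"

inductive_set orbit :: "(complex fps mat \<Rightarrow> 'v \<Rightarrow> 'v) \<Rightarrow> complex fps mat set \<Rightarrow> 'v \<Rightarrow> 'v set"
  for \<rho> L v where
  base: "v \<in> orbit \<rho> L v"
| step: "x \<in> L \<Longrightarrow> w \<in> orbit \<rho> L v \<Longrightarrow> \<rho> x w \<in> orbit \<rho> L v"

text \<open>\<open>U(L).v\<close>, the span of all \<open>x\<^sub>1\<cdots>x\<^sub>k.v\<close> with \<open>x\<^sub>i\<close> in \<open>L\<close>.\<close>

definition env_span ::
  "(complex \<Rightarrow> 'v::ab_group_add \<Rightarrow> 'v) \<Rightarrow> (complex fps mat \<Rightarrow> 'v \<Rightarrow> 'v) \<Rightarrow> complex fps mat set \<Rightarrow> 'v \<Rightarrow> 'v set" where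
  "env_span s \<rho> L v = module.span s (orbit \<rho> L v)"

definition cyclic_graded_module ::
  "nat \<Rightarrow> (complex \<Rightarrow> 'v::ab_group_add \<Rightarrow> 'v) \<Rightarrow> 'v set \<Rightarrow> (complex fps mat \<Rightarrow> 'v \<Rightarrow> 'v) \<Rightarrow> 'v \<Rightarrow> bool" where
  "cyclic_graded_module n s D \<rho> v \<longleftrightarrow>
     lie_module (sl n) s D \<rho> \<and>
     (\<exists>B. finite B \<and> D = module.span s B) \<and>
     graded_module n s D \<rho> \<and>
     v \<in> D \<and>
     v \<noteq> 0 \<and> (\<exists>wt. \<forall>h\<in>cartan n. \<rho> (const_mat h) v = s (wt h) v) \<and>
     (\<forall>x\<in>nil_minus n \<inter> poly_mats. \<rho> x v = 0) \<and>
     (\<forall>h\<in>cartan n \<inter> poly_mats. \<rho> (fps_X \<cdot>\<^sub>m h) v = 0) \<and>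
     env_span s \<rho> (nil_plus n \<inter> poly_mats) v = D"

text \<open>
  With positions numbered from \<open>0\<close>, this is the condition \<open>i \<le> b < j\<close> for the
  positions \<open>i + 1\<close>, \<open>j + 1\<close> numbered from \<open>1\<close>.
\<close>

definition crosses :: "nat \<Rightarrow> nat \<Rightarrow> nat \<Rightarrow> bool" where
  "crosses b i j \<longleftrightarrow> Suc i \<le> b \<and> b < Suc j"

definition sh :: "nat \<Rightarrow> nat \<Rightarrow> complex \<Rightarrow> complex fps mat \<Rightarrow> complex fps mat" where
  "sh n b \<epsilon> A = mat n n (\<lambda>(i, j).
     if crosses b i j then (fps_X + fps_const \<epsilon>) * A $$ (i, j) else A $$ (i, j))"

definition admissible ::
  "nat \<Rightarrow> nat \<Rightarrow> (complex \<Rightarrow> 'v::ab_group_add \<Rightarrow> 'v) \<Rightarrow> 'v set \<Rightarrow> (complex fps mat \<Rightarrow> 'v \<Rightarrow> 'v) \<Rightarrow> 'v \<Rightarrow> bool" where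
  "admissible n b s D \<rho> v \<longleftrightarrow>
     (\<forall>\<epsilon>. \<epsilon> \<noteq> 0 \<longrightarrow>
        (\<exists>f. bij_betw f D D \<and>
             (\<forall>u\<in>D. \<forall>w\<in>D. f (u + w) = f u + f w) \<and>
             (\<forall>c. \<forall>u\<in>D. f (s c u) = s c (f u)) \<and>
             f v = v \<and>
             (\<forall>x\<in>nil_plus n. \<forall>d\<in>D. f (\<rho> x d) = \<rho> (sh n b \<epsilon> x) (f d))))"


subsection \<open>The tensor product of the modules\<close>

definition multilinear_on ::
  "nat \<Rightarrow> (complex \<Rightarrow> 'v::ab_group_add \<Rightarrow> 'v) \<Rightarrow> (nat \<Rightarrow> 'v set)
    \<Rightarrow> (complex \<Rightarrow> 'w::ab_group_add \<Rightarrow> 'w) \<Rightarrow> ((nat \<Rightarrow> 'v) \<Rightarrow> 'w) \<Rightarrow> bool" where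
  "multilinear_on n s D sW f \<longleftrightarrow>
     (\<forall>d \<in> Pi\<^sub>E {..<n} D. \<forall>b<n. \<forall>u\<in>D b. \<forall>w\<in>D b. \<forall>c.
        f (d(b := u + w)) = f (d(b := u)) + f (d(b := w)) \<and>
        f (d(b := s c u)) = sW c (f (d(b := u))))"

definition forms ::
  "nat \<Rightarrow> (complex \<Rightarrow> 'v::ab_group_add \<Rightarrow> 'v) \<Rightarrow> (nat \<Rightarrow> 'v set) \<Rightarrow> ((nat \<Rightarrow> 'v) \<Rightarrow> complex) set" where
  "forms n s D = {m. multilinear_on n s D (*) m}"

text \<open>
  \<open>\<Otimes>\<^sub>b D\<^sub>b\<close> is realized in the dual of the space of multilinear forms on the \<open>D\<^sub>b\<close>, where
  \<open>\<Otimes>\<^sub>b d\<^sub>b\<close> is evaluation at \<open>d\<close>; the universal property is proved below as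
  \<open>multilinear_pure_tensor\<close> and \<open>tensor_space_universal\<close>.
\<close>

type_synonym 'v tensor = "((nat \<Rightarrow> 'v) \<Rightarrow> complex) \<Rightarrow> complex"

definition tensor_scale :: "complex \<Rightarrow> 'v tensor \<Rightarrow> 'v tensor" where
  "tensor_scale c t = (\<lambda>m. c * t m)"

definition pure_tensor ::
  "nat \<Rightarrow> (complex \<Rightarrow> 'v::ab_group_add \<Rightarrow> 'v) \<Rightarrow> (nat \<Rightarrow> 'v set) \<Rightarrow> (nat \<Rightarrow> 'v) \<Rightarrow> 'v tensor" where
  "pure_tensor n s D d = (\<lambda>m. if m \<in> forms n s D then m d else 0)"

definition tensor_space ::
  "nat \<Rightarrow> (complex \<Rightarrow> 'v::ab_group_add \<Rightarrow> 'v) \<Rightarrow> (nat \<Rightarrow> 'v set) \<Rightarrow> 'v tensor set" where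
  "tensor_space n s D = module.span tensor_scale (pure_tensor n s D ` Pi\<^sub>E {..<n} D)"

lemma vector_space_tensor: "vector_space tensor_scale"
  by standard (auto simp: tensor_scale_def fun_eq_iff algebra_simps)

lemma vector_space_complex: "vector_space ((*) :: complex \<Rightarrow> complex \<Rightarrow> complex)"
  by standard (auto simp: algebra_simps)

lemma multilinear_pure_tensor: "multilinear_on n s D tensor_scale (pure_tensor n s D)"
  unfolding multilinear_on_def pure_tensor_def tensor_scale_def forms_def
  by (auto simp: fun_eq_iff multilinear_on_def)

lemma tensor_space_universal:
  fixes f :: "(nat \<Rightarrow> 'v::ab_group_add) \<Rightarrow> 'w::ab_group_add"
  assumes W: "vector_space sW" and f: "multilinear_on n s D sW f"
  shows "\<exists>g. Vector_Spaces.linear tensor_scale sW g \<and>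
             (\<forall>d \<in> Pi\<^sub>E {..<n} D. g (pure_tensor n s D d) = f d)"
proof -
  interpret T: vector_space "tensor_scale :: complex \<Rightarrow> 'v tensor \<Rightarrow> 'v tensor"
    by (rule vector_space_tensor)
  interpret W: vector_space sW by fact
  interpret TW: vector_space_pair "tensor_scale :: complex \<Rightarrow> 'v tensor \<Rightarrow> 'v tensor" sW ..
  interpret C: vector_space "(*) :: complex \<Rightarrow> complex \<Rightarrow> complex" by (rule vector_space_complex)
  interpret WC: vector_space_pair sW "(*) :: complex \<Rightarrow> complex \<Rightarrow> complex" ..
  let ?P = "Pi\<^sub>E {..<n} D" and ?t = "pure_tensor n s D"
  obtain B where B: "B \<subseteq> ?t ` ?P" "T.independent B" "?t ` ?P \<subseteq> T.span B"
    using T.maximal_independent_subset by blast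
  define pick where "pick t = (SOME d. d \<in> ?P \<and> ?t d = t)" for t
  have pick: "pick t \<in> ?P \<and> ?t (pick t) = t" if "t \<in> B" for t
  proof -
    have "\<exists>d. d \<in> ?P \<and> ?t d = t" using that B(1) by blast
    then show ?thesis unfolding pick_def by (rule someI_ex)
  qed
  define g where "g = TW.construct B (\<lambda>t. f (pick t))"
  have lin: "Vector_Spaces.linear tensor_scale sW g"
    unfolding g_def by (rule TW.linear_construct) (rule B)
  interpret g: Vector_Spaces.linear tensor_scale sW g by (rule lin)
  have gB: "g t = f (pick t)" if "t \<in> B" for t
    unfolding g_def by (rule TW.construct_basis) (use B that in auto)
  have "g (?t d) = f d" if d: "d \<in> ?P" for d
  proof (rule ccontr)
    assume ne: "g (?t d) \<noteq> f d"
    define w where "w = g (?t d) - f d"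
    have "W.independent {w}" using ne by (simp add: w_def W.dependent_single)
    then obtain h where h: "Vector_Spaces.linear sW (*) h" "h w = (1::complex)"
      using WC.linear_construct[of "{w}" "\<lambda>_. 1"] WC.construct_basis[of "{w}" w "\<lambda>_. 1"] by blast
    interpret h: Vector_Spaces.linear sW "(*) :: complex \<Rightarrow> complex \<Rightarrow> complex" h by (rule h(1))
    have hf: "(\<lambda>d. h (f d)) \<in> forms n s D"
      using f unfolding forms_def multilinear_on_def by (auto simp: h.add h.scale)
    have ev: "?t e (\<lambda>d. h (f d)) = h (f e)" for e
      using hf by (simp add: pure_tensor_def)
    have "?t d \<in> T.span B" using B(3) d by blast
    then have "h (g (?t d)) = ?t d (\<lambda>d. h (f d))"
    proof (induction rule: T.span_induct_alt)
      case base
      show ?case using g.zero h.zero by (simp add: zero_fun_def)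
    next
      case (step c x y)
      have "h (g x) = x (\<lambda>d. h (f d))"
        using gB[OF step(1)] pick[OF step(1)] ev[of "pick x"] by simp
      moreover have "h (g (tensor_scale c x + y)) = c * h (g x) + h (g y)"
        by (simp only: g.add g.scale h.add h.scale)
      ultimately show ?case
        using step(2) by (simp add: tensor_scale_def plus_fun_def)
    qed
    then have "h w = 0" by (simp add: w_def h.diff ev)
    with h(2) show False by simp
  qed
  with lin show ?thesis by blast
qed

text \<open>The \<open>\<g>\<l>\<^sub>n(\<O>)\<close>-module obtained from an \<open>\<s>\<l>\<^sub>n(\<O>)\<close>-module by letting scalar matrices act by \<open>0\<close>.\<close>

definition gl_ext ::
  "nat \<Rightarrow> (complex fps mat \<Rightarrow> 'v \<Rightarrow> 'v) \<Rightarrow> complex fps mat \<Rightarrow> 'v \<Rightarrow> 'v" where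
  "gl_ext n \<rho> A = \<rho> (A - (fps_const (1 / of_nat n) * mat_tr A) \<cdot>\<^sub>m 1\<^sub>m n)"

text \<open>
  The action of a tuple \<open>(x\<^sub>b)\<^sub>b\<close> of matrices, its \<open>b\<close>-th component acting on the \<open>b\<close>-th factor.
  This is the transpose of the operation on forms; see \<open>tensor_act_pure\<close> below for the
  action on \<open>\<Otimes>\<^sub>b d\<^sub>b\<close>.
\<close>

definition tensor_act ::
  "nat \<Rightarrow> (complex \<Rightarrow> 'v::ab_group_add \<Rightarrow> 'v) \<Rightarrow> (nat \<Rightarrow> 'v set) \<Rightarrow> (nat \<Rightarrow> complex fps mat \<Rightarrow> 'v \<Rightarrow> 'v)
    \<Rightarrow> (nat \<Rightarrow> complex fps mat) \<Rightarrow> 'v tensor \<Rightarrow> 'v tensor" where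
  "tensor_act n s D \<rho> x t = (\<lambda>m.
     if m \<in> forms n s D
     then t (\<lambda>d. \<Sum>b<n. m (d(b := gl_ext n (\<rho> b) (x b) (d b))))
     else 0)"

lemma multilinear_on_deriv:
  assumes m: "multilinear_on n s D (*) (m :: _ \<Rightarrow> complex)" and F: "\<And>b u. b < n \<Longrightarrow> u \<in> D b \<Longrightarrow> F b u \<in> D b"
    and add: "\<And>b u w. b < n \<Longrightarrow> u \<in> D b \<Longrightarrow> w \<in> D b \<Longrightarrow> F b (u + w) = F b u + F b w"
    and scale: "\<And>b u c. b < n \<Longrightarrow> u \<in> D b \<Longrightarrow> F b (s c u) = s c (F b u)"
    and sub: "\<And>b. b < n \<Longrightarrow> module.subspace s (D b)" and s: "vector_space s"
  shows "multilinear_on n s D (*) (\<lambda>d. \<Sum>b<n. m (d(b := F b (d b))))"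
  unfolding multilinear_on_def
proof (intro ballI allI impI)
  interpret vector_space s by fact
  fix d b u w c
  assume d: "d \<in> Pi\<^sub>E {..<n} D" and b: "b < n" and u: "u \<in> D b" and w: "w \<in> D b"
  have upd: "d(k := e) \<in> Pi\<^sub>E {..<n} D" if "k < n" "e \<in> D k" for k e
    using d that by (auto simp: PiE_iff extensional_def)
  have dk: "d k \<in> D k" if "k < n" for k using d that by (auto simp: PiE_iff)
  have A: "m (e(b := x + y)) = m (e(b := x)) + m (e(b := y))"
    if "e \<in> Pi\<^sub>E {..<n} D" "x \<in> D b" "y \<in> D b" for e x y
    using m b that unfolding multilinear_on_def by blast
  have S: "m (e(b := s c x)) = c * m (e(b := x))"
    if "e \<in> Pi\<^sub>E {..<n} D" "x \<in> D b" for e x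
    using m b that unfolding multilinear_on_def by blast
  let ?T = "\<lambda>x k. m ((d(b := x))(k := F k ((d(b := x)) k)))"
  have "?T (u + w) k = ?T u k + ?T w k \<and> ?T (s c u) k = c * ?T u k" if k: "k < n" for k
  proof (cases "k = b")
    case True
    with A[OF d F[OF b u] F[OF b w]] S[OF d F[OF b u]] show ?thesis
      using b u w by (simp add: add scale)
  next
    case False
    have tw: "(d(b := x))(k := F k ((d(b := x)) k)) = (d(k := F k (d k)))(b := x)" for x
      using False by (simp add: fun_upd_twist)
    have "d(k := F k (d k)) \<in> Pi\<^sub>E {..<n} D" using upd[OF k F[OF k dk[OF k]]] .
    from A[OF this u w] S[OF this u] show ?thesis unfolding tw by blast
  qed
  then show "(\<Sum>k<n. ?T (u + w) k) = (\<Sum>k<n. ?T u k) + (\<Sum>k<n. ?T w k) \<and>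
        (\<Sum>k<n. ?T (s c u) k) = c * (\<Sum>k<n. ?T u k)"
    by (simp add: sum.distrib sum_distrib_left)
qed

lemma gl_ext_sl:
  fixes A :: "complex fps mat"
  assumes "A \<in> carrier_mat n n" "n > 0"
  shows "A - (fps_const (1 / of_nat n) * mat_tr A) \<cdot>\<^sub>m 1\<^sub>m n \<in> sl n"
proof -
  let ?c = "fps_const (1 / of_nat n) * mat_tr A"
  have "mat_tr (A - ?c \<cdot>\<^sub>m 1\<^sub>m n) = mat_tr A - of_nat n * ?c"
    using assms by (simp add: mat_tr_def sum_subtractf)
  also have "of_nat n * ?c = mat_tr A"
    using assms(2) by (simp add: fps_of_nat[symmetric] mult.assoc[symmetric] del: fps_of_nat)
  finally show ?thesis using assms by (auto simp: sl_def)
qed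

lemma tensor_act_pure:
  assumes s: "vector_space s" and n: "n > 0"
    and \<rho>: "\<And>b. b < n \<Longrightarrow> lie_module (sl n) s (D b) (\<rho> b)"
    and x: "\<And>b. b < n \<Longrightarrow> x b \<in> carrier_mat n n" and d: "d \<in> Pi\<^sub>E {..<n} D"
  shows "tensor_act n s D \<rho> x (pure_tensor n s D d) =
    (\<Sum>b<n. pure_tensor n s D (d(b := gl_ext n (\<rho> b) (x b) (d b))))"
proof
  fix m
  have fs: "(\<Sum>b<n. G b) m = (\<Sum>b<n. G b m)" for G :: "nat \<Rightarrow> 'a tensor"
    by (induction n) auto
  show "tensor_act n s D \<rho> x (pure_tensor n s D d) m =
    (\<Sum>b<n. pure_tensor n s D (d(b := gl_ext n (\<rho> b) (x b) (d b)))) m"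
  proof (cases "m \<in> forms n s D")
    case True
    have "(\<lambda>d. \<Sum>b<n. m (d(b := gl_ext n (\<rho> b) (x b) (d b)))) \<in> forms n s D"
      unfolding forms_def mem_Collect_eq
      by (rule multilinear_on_deriv)
        (use True \<rho> gl_ext_sl[OF x n] s in \<open>auto simp: forms_def lie_module_def gl_ext_def\<close>)
    then show ?thesis using True by (simp add: tensor_act_def pure_tensor_def fs)
  next
    case False
    then show ?thesis by (simp add: tensor_act_def pure_tensor_def fs)
  qed
qed


subsection \<open>The Lie algebras \<open>\<a>(\<epsilon>)\<close>\<close>

definition mat_unit :: "nat \<Rightarrow> nat \<Rightarrow> nat \<Rightarrow> 'r::comm_ring_1 mat" where
  "mat_unit n i j = mat n n (\<lambda>(k, l). if k = i \<and> l = j then 1 else 0)"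

text \<open>
  The \<open>\<O>\<close>-span of the defining tuples, over any commutative ring containing \<open>\<O>\<close> (via \<open>\<iota>\<close>)
  and an element \<open>w\<close> playing the role of \<open>z + \<epsilon>\<close>.
  Elements of \<open>\<Oplus>\<^sub>b \<g>\<l>\<^sub>n\<close> are functions on \<open>{..<n}\<close>.
\<close>

inductive_set tuple_alg :: "nat \<Rightarrow> (complex fps \<Rightarrow> 'r::comm_ring_1) \<Rightarrow> 'r \<Rightarrow> (nat \<Rightarrow> 'r mat) set"
  for n \<iota> w where
  diag: "i < n \<Longrightarrow> (\<lambda>b\<in>{..<n}. mat_unit n i i) \<in> tuple_alg n \<iota> w"
| upper: "i < j \<Longrightarrow> j < n \<Longrightarrow>
    (\<lambda>b\<in>{..<n}. if crosses b i j then w \<cdot>\<^sub>m mat_unit n i j else mat_unit n i j) \<in> tuple_alg n \<iota> w"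
| lower: "i < j \<Longrightarrow> j < n \<Longrightarrow>
    (\<lambda>b\<in>{..<n}. if crosses b i j then mat_unit n j i else w \<cdot>\<^sub>m mat_unit n j i) \<in> tuple_alg n \<iota> w"
| add: "x \<in> tuple_alg n \<iota> w \<Longrightarrow> y \<in> tuple_alg n \<iota> w \<Longrightarrow>
    (\<lambda>b\<in>{..<n}. x b + y b) \<in> tuple_alg n \<iota> w"
| scale: "x \<in> tuple_alg n \<iota> w \<Longrightarrow> (\<lambda>b\<in>{..<n}. \<iota> c \<cdot>\<^sub>m x b) \<in> tuple_alg n \<iota> w"

definition alg_at :: "nat \<Rightarrow> complex \<Rightarrow> (nat \<Rightarrow> complex fps mat) set" where
  "alg_at n \<epsilon> = tuple_alg n (\<lambda>c. c) (fps_X + fps_const \<epsilon>)"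

text \<open>
  Here \<open>\<epsilon>\<close> is a formal variable: matrix entries lie in \<open>\<O>[\<epsilon>]\<close>, and \<open>[:fps_X, 1:]\<close> is \<open>z + \<epsilon>\<close>.
\<close>

definition alg_formal :: "nat \<Rightarrow> (nat \<Rightarrow> complex fps poly mat) set" where
  "alg_formal n = tuple_alg n (\<lambda>c. [:c:]) [:fps_X, 1:]"

text \<open>Linear over \<open>\<O>\<close>, hence in particular over \<open>\<complex>\<close>; the operations on tuples are componentwise.\<close>

definition lie_iso :: "nat \<Rightarrow> complex fps mat set \<Rightarrow> (nat \<Rightarrow> complex fps mat) set
    \<Rightarrow> (complex fps mat \<Rightarrow> nat \<Rightarrow> complex fps mat) \<Rightarrow> bool" where
  "lie_iso n L K \<phi> \<longleftrightarrow>
     bij_betw \<phi> L K \<and>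
     (\<forall>x\<in>L. \<forall>y\<in>L. \<phi> (x + y) = (\<lambda>b\<in>{..<n}. \<phi> x b + \<phi> y b)) \<and>
     (\<forall>c. \<forall>x\<in>L. \<phi> (c \<cdot>\<^sub>m x) = (\<lambda>b\<in>{..<n}. c \<cdot>\<^sub>m \<phi> x b)) \<and>
     (\<forall>x\<in>L. \<forall>y\<in>L. \<phi> (lie_br x y) = (\<lambda>b\<in>{..<n}. lie_br (\<phi> x b) (\<phi> y b)))"


subsection \<open>The limit \<open>\<D>(0)\<close>\<close>

text \<open>
  Elements of \<open>T[\<epsilon>]\<close> are polynomials in \<open>\<epsilon>\<close> with all coefficients in \<open>T\<close>; multiplication by \<open>\<epsilon>\<close>
  is \<^term>\<open>pCons 0\<close> and evaluation at \<open>\<epsilon> = 0\<close> is the coefficient at \<open>0\<close>.  The product of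
  \<open>\<Sum>\<^sub>i a\<^sub>i \<epsilon>\<^sup>i\<close> and \<open>\<Sum>\<^sub>j p\<^sub>j \<epsilon>\<^sup>j\<close> induced by a bilinear operation:
\<close>

definition conv :: "('a \<Rightarrow> 't \<Rightarrow> 't::ab_group_add) \<Rightarrow> (nat \<Rightarrow> 'a) \<Rightarrow> 't poly \<Rightarrow> 't poly" where
  "conv f a p = Abs_poly (\<lambda>k. \<Sum>i\<le>k. f (a i) (coeff p (k - i)))"

text \<open>The coefficients of a tuple of matrices over \<open>\<O>[\<epsilon>]\<close> at powers of \<open>\<epsilon>\<close>.\<close>

definition tuple_coeff :: "nat \<Rightarrow> (nat \<Rightarrow> complex fps poly mat) \<Rightarrow> nat \<Rightarrow> nat \<Rightarrow> complex fps mat" where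
  "tuple_coeff n x i = (\<lambda>b\<in>{..<n}. map_mat (\<lambda>q. coeff q i) (x b))"

inductive_set formal_module ::
  "nat \<Rightarrow> (complex \<Rightarrow> 'v::ab_group_add \<Rightarrow> 'v) \<Rightarrow> (nat \<Rightarrow> 'v set) \<Rightarrow> (nat \<Rightarrow> complex fps mat \<Rightarrow> 'v \<Rightarrow> 'v)
    \<Rightarrow> (nat \<Rightarrow> 'v) \<Rightarrow> 'v tensor poly set"
  for n s D \<rho> v where
  base: "[:pure_tensor n s D (restrict v {..<n}):] \<in> formal_module n s D \<rho> v"
| act: "x \<in> alg_formal n \<Longrightarrow> p \<in> formal_module n s D \<rho> v \<Longrightarrow>
    conv (tensor_act n s D \<rho>) (tuple_coeff n x) p \<in> formal_module n s D \<rho> v"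
| add: "p \<in> formal_module n s D \<rho> v \<Longrightarrow> q \<in> formal_module n s D \<rho> v \<Longrightarrow>
    p + q \<in> formal_module n s D \<rho> v"
| scale: "p \<in> formal_module n s D \<rho> v \<Longrightarrow>
    conv tensor_scale (coeff c) p \<in> formal_module n s D \<rho> v"

definition limit_module ::
  "nat \<Rightarrow> (complex \<Rightarrow> 'v::ab_group_add \<Rightarrow> 'v) \<Rightarrow> (nat \<Rightarrow> 'v set) \<Rightarrow> (nat \<Rightarrow> complex fps mat \<Rightarrow> 'v \<Rightarrow> 'v)
    \<Rightarrow> (nat \<Rightarrow> 'v) \<Rightarrow> 'v tensor set" where
  "limit_module n s D \<rho> v =
     {coeff q 0 | q r. (\<forall>k. coeff q k \<in> tensor_space n s D) \<and>
                       ((pCons 0) ^^ r) q \<in> formal_module n s D \<rho> v}"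

end

theory Submission
  imports Defs
begin

text \<open>
  Every element of \<open>\<a>(0)\<close> is the value at \<open>\<epsilon> = 0\<close> of an element \<open>X\<close> of the formal Lie algebra, and
  the action of \<open>X\<close> is \<open>\<complex>[\<epsilon>]\<close>-linear: if \<open>\<epsilon>\<^sup>r q \<in> M\<close> then \<open>\<epsilon>\<^sup>r (X q) = X (\<epsilon>\<^sup>r q) \<in> M\<close>, and the
  constant term of \<open>X q\<close> is that of \<open>X\<close> applied to that of \<open>q\<close>.  This gives the stability of
  \<open>\<D>(0)\<close>.  At \<open>\<epsilon> = 0\<close> the \<open>b\<close>-th component of \<open>\<a>(0)\<close> is the conjugate of the Iwahori algebra by
  the diagonal matrix with \<open>b\<close> entries \<open>z\<close> followed by entries \<open>1\<close>, and the component \<open>b = 0\<close> is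
  the Iwahori algebra itself, whence the isomorphism.
\<close>

subsection \<open>The Iwahori algebra and \<open>\<a>(0)\<close>\<close>

text \<open>The diagonal is kept as a function of the index, so that conjugation can be stated
  entrywise without inverting z.\<close>

definition conj_diag :: "nat \<Rightarrow> nat \<Rightarrow> complex fps" where
  "conj_diag b i = (if i < b then fps_X else 1)"

text \<open>Conjugation multiplies the entry \<open>(k, l)\<close> by
  \<open>conj_diag b k / conj_diag b l\<close>, that is by z, 1/z or 1. The shift stands for 1/z; it
  is a true division because it meets only entries below the diagonal, which in the Iwahori algebra
  have constant term 0.\<close>

definition iwahori_emb :: "nat \<Rightarrow> complex fps mat \<Rightarrow> nat \<Rightarrow> complex fps mat" where
  "iwahori_emb n A = (\<lambda>b\<in>{..<n}. mat n n (\<lambda>(k, l).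
     if crosses b k l then fps_X * A $$ (k, l)
     else if crosses b l k then fps_shift 1 (A $$ (k, l)) else A $$ (k, l)))"

lemma fps_X_times_shift:
  fixes f :: "complex fps"
  assumes "fps_nth f 0 = 0"
  shows "fps_X * fps_shift 1 f = f"
  by (rule fps_ext) (use assms in \<open>auto simp: fps_X_mult_nth\<close>)

section \<open>Closure of the Iwahori algebra under ring operations\<close>

lemma iwahoriD:
  assumes "A \<in> iwahori n"
  shows "A \<in> carrier_mat n n" "\<And>i j. i < n \<Longrightarrow> j < i \<Longrightarrow> fps_nth (A $$ (i, j)) 0 = 0"
  using assms by (auto simp: iwahori_def upper_triangular_def)

lemma iwahoriI:
  assumes "A \<in> carrier_mat n n" "\<And>i j. i < n \<Longrightarrow> j < i \<Longrightarrow> fps_nth (A $$ (i, j)) 0 = 0"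
  shows "A \<in> iwahori n"
  using assms by (auto simp: iwahori_def)

lemma iwahori_add: "A \<in> iwahori n \<Longrightarrow> B \<in> iwahori n \<Longrightarrow> A + B \<in> iwahori n"
  by (rule iwahoriI) (use iwahoriD[of A n] iwahoriD[of B n] in auto)

lemma iwahori_smult: "A \<in> iwahori n \<Longrightarrow> c \<cdot>\<^sub>m A \<in> iwahori n"
  by (rule iwahoriI) (use iwahoriD[of A n] in auto)

lemma iwahori_minus: "A \<in> iwahori n \<Longrightarrow> B \<in> iwahori n \<Longrightarrow> A - B \<in> iwahori n"
  by (rule iwahoriI) (use iwahoriD[of A n] iwahoriD[of B n] in auto)

lemma mat_mult_entry:
  assumes "A \<in> carrier_mat n n" "B \<in> carrier_mat n n" "i < n" "j < n"
  shows "(A * B) $$ (i, j) = (\<Sum>k<n. A $$ (i, k) * B $$ (k, j))"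
  using assms by (simp add: scalar_prod_def lessThan_atLeast0)

lemma iwahori_mult:
  assumes A: "A \<in> iwahori n" and B: "B \<in> iwahori n"
  shows "A * B \<in> iwahori n"
proof (rule iwahoriI)
  note cA = iwahoriD[OF A] and cB = iwahoriD[OF B]
  show "A * B \<in> carrier_mat n n" using cA cB by auto
  fix i j assume ij: "i < n" "j < i"
  \<comment> \<open>Either \<open>k < i\<close>, or \<open>j < i <= k\<close>; so one of the two
    factors lies below the diagonal.\<close>
  have "fps_nth (A $$ (i, k) * B $$ (k, j)) 0 = 0" if "k < n" for k
    using cA(2)[of i k] cB(2)[of k j] ij that by (cases "k < i") auto
  then show "fps_nth ((A * B) $$ (i, j)) 0 = 0"
    using ij cA(1) cB(1) by (simp add: mat_mult_entry fps_sum_nth del: fps_mult_nth_0 index_mult_mat)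
qed

section \<open>Conjugation as a homomorphism\<close>

lemma iwahori_emb_carrier: "b < n \<Longrightarrow> iwahori_emb n A b \<in> carrier_mat n n"
  by (simp add: iwahori_emb_def)

text \<open>Conjugation with the inverse cleared. The Iwahori condition enters where
  \<open>l < b <= k\<close>: the entry is then divisible by z and the shift is exact.\<close>

lemma iwahori_emb_conj:
  assumes "A \<in> iwahori n" "b < n" "k < n" "l < n"
  shows "iwahori_emb n A b $$ (k, l) * conj_diag b l = conj_diag b k * A $$ (k, l)"
  using iwahoriD(2)[OF assms(1), of k l] assms(2-) fps_X_times_shift[of "A $$ (k, l)"]
  by (auto simp: iwahori_emb_def conj_diag_def crosses_def mult.commute)

text \<open>The power series ring is a domain and \<open>conj_diag\<close> never vanishes, so it can
  be cancelled. The homomorphism laws below thus reduce to checking the intertwining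
  relation.\<close>

lemma iwahori_emb_eqI:
  assumes "A \<in> iwahori n" "b < n" "M \<in> carrier_mat n n"
    and "\<And>k l. k < n \<Longrightarrow> l < n \<Longrightarrow> M $$ (k, l) * conj_diag b l = conj_diag b k * A $$ (k, l)"
  shows "iwahori_emb n A b = M"
proof (rule eq_matI)
  fix k l assume "k < dim_row M" "l < dim_col M"
  then have kl: "k < n" "l < n" using assms(3) by auto
  have "iwahori_emb n A b $$ (k, l) * conj_diag b l = M $$ (k, l) * conj_diag b l"
    by (rule trans[OF iwahori_emb_conj[OF assms(1,2) kl] assms(4)[OF kl, symmetric]])
  moreover have "conj_diag b l \<noteq> 0" by (simp add: conj_diag_def)
  ultimately show "iwahori_emb n A b $$ (k, l) = M $$ (k, l)"
    by (simp only: mult_cancel_right simp_thms)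
qed (use assms(2,3) in \<open>auto simp: iwahori_emb_def\<close>)

lemma iwahori_emb_extensional: "restrict (iwahori_emb n A) {..<n} = iwahori_emb n A"
  by (auto simp: iwahori_emb_def)

lemma iwahori_emb_restrictI:
  assumes "\<And>b. b < n \<Longrightarrow> iwahori_emb n A b = F b"
  shows "iwahori_emb n A = (\<lambda>b\<in>{..<n}. F b)"
  by (subst iwahori_emb_extensional[symmetric]) (use assms in auto)

lemma iwahori_emb_add:
  assumes A: "A \<in> iwahori n" and B: "B \<in> iwahori n"
  shows "iwahori_emb n (A + B) = (\<lambda>b\<in>{..<n}. iwahori_emb n A b + iwahori_emb n B b)"
proof (rule iwahori_emb_restrictI, rule iwahori_emb_eqI)
  fix b k l assume b: "b < n" and kl: "k < n" "l < n"
  show "(iwahori_emb n A b + iwahori_emb n B b) $$ (k, l) * conj_diag b l =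
      conj_diag b k * (A + B) $$ (k, l)"
    using iwahori_emb_conj[OF A b kl] iwahori_emb_conj[OF B b kl] b kl iwahoriD(1)[OF A]
      iwahoriD(1)[OF B] iwahori_emb_carrier[OF b, of A] iwahori_emb_carrier[OF b, of B]
    by (simp add: distrib_left distrib_right)
qed (use assms iwahori_emb_carrier iwahori_add in auto)

lemma iwahori_emb_smult:
  assumes A: "A \<in> iwahori n"
  shows "iwahori_emb n (c \<cdot>\<^sub>m A) = (\<lambda>b\<in>{..<n}. c \<cdot>\<^sub>m iwahori_emb n A b)"
proof (rule iwahori_emb_restrictI, rule iwahori_emb_eqI)
  fix b k l assume b: "b < n" and kl: "k < n" "l < n"
  show "(c \<cdot>\<^sub>m iwahori_emb n A b) $$ (k, l) * conj_diag b l = conj_diag b k * (c \<cdot>\<^sub>m A) $$ (k, l)"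
    using iwahori_emb_conj[OF A b kl] kl iwahoriD(1)[OF A] iwahori_emb_carrier[OF b, of A]
    by (simp add: mult.assoc mult.left_commute)
qed (use assms iwahori_emb_carrier iwahori_smult in auto)

lemma iwahori_emb_mult:
  assumes A: "A \<in> iwahori n" and B: "B \<in> iwahori n" and b: "b < n"
  shows "iwahori_emb n (A * B) b = iwahori_emb n A b * iwahori_emb n B b"
proof (rule iwahori_emb_eqI[OF iwahori_mult[OF A B] b])
  note cA = iwahori_emb_carrier[OF b, of A] and cB = iwahori_emb_carrier[OF b, of B]
  show "iwahori_emb n A b * iwahori_emb n B b \<in> carrier_mat n n" using cA cB by auto
  fix k l assume kl: "k < n" "l < n"
  let ?A = "\<lambda>i j. iwahori_emb n A b $$ (i, j)" and ?B = "\<lambda>i j. iwahori_emb n B b $$ (i, j)"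
  \<comment> \<open>The diagonal factor moves left, first past \<open>B\<close> with index
    \<open>i\<close>, then past \<open>A\<close> with index \<open>k\<close>.\<close>
  have "?A k i * ?B i l * conj_diag b l = conj_diag b k * (A $$ (k, i) * B $$ (i, l))" if i: "i < n" for i
  proof -
    have "?A k i * ?B i l * conj_diag b l = ?A k i * conj_diag b i * B $$ (i, l)"
      using iwahori_emb_conj[OF B b i kl(2)] by (simp add: mult.assoc)
    then show ?thesis using iwahori_emb_conj[OF A b kl(1) i] by (simp add: mult.assoc)
  qed
  then show "(iwahori_emb n A b * iwahori_emb n B b) $$ (k, l) * conj_diag b l =
      conj_diag b k * (A * B) $$ (k, l)"
    unfolding mat_mult_entry[OF cA cB kl] mat_mult_entry[OF iwahoriD(1)[OF A] iwahoriD(1)[OF B] kl]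
    by (simp add: sum_distrib_left sum_distrib_right)
qed

lemma iwahori_emb_minus:
  assumes A: "A \<in> iwahori n" and B: "B \<in> iwahori n" and b: "b < n"
  shows "iwahori_emb n (A - B) b = iwahori_emb n A b - iwahori_emb n B b"
proof (rule iwahori_emb_eqI[OF iwahori_minus[OF A B] b])
  fix k l assume kl: "k < n" "l < n"
  show "(iwahori_emb n A b - iwahori_emb n B b) $$ (k, l) * conj_diag b l =
      conj_diag b k * (A - B) $$ (k, l)"
    using iwahori_emb_conj[OF A b kl] iwahori_emb_conj[OF B b kl] b kl iwahoriD(1)[OF A]
      iwahoriD(1)[OF B] iwahori_emb_carrier[OF b, of A] iwahori_emb_carrier[OF b, of B]
    by (simp add: left_diff_distrib right_diff_distrib)
qed (use iwahori_emb_carrier[OF b] in \<open>auto intro!: minus_carrier_mat\<close>)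

lemma iwahori_emb_lie_br:
  assumes "A \<in> iwahori n" "B \<in> iwahori n"
  shows "iwahori_emb n (lie_br A B) =
    (\<lambda>b\<in>{..<n}. lie_br (iwahori_emb n A b) (iwahori_emb n B b))"
  by (rule iwahori_emb_restrictI)
    (use assms in \<open>simp add: lie_br_def iwahori_emb_minus iwahori_emb_mult iwahori_mult\<close>)

section \<open>Bijectivity onto the limit algebra\<close>

lemma iwahori_emb_inj:
  assumes "0 < n"
  shows "inj_on (iwahori_emb n) (iwahori n)"
proof (rule inj_onI)
  fix A B assume A: "A \<in> iwahori n" and B: "B \<in> iwahori n" and eq: "iwahori_emb n A = iwahori_emb n B"
  \<comment> \<open>For \<open>b = 0\<close> the conjugating matrix is the identity, so component 0
    recovers the matrix.\<close>
  have "iwahori_emb n C 0 = C" if C: "C \<in> iwahori n" for C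
    by (rule iwahori_emb_eqI[OF C assms iwahoriD(1)[OF C]]) (simp add: conj_diag_def)
  then have "A = iwahori_emb n A 0" "B = iwahori_emb n B 0" using A B by auto
  then show "A = B" unfolding eq by (rule trans[OF _ sym])
qed

text \<open>The image is closed under sums and power series multiples, so generators suffice.
  Diagonal and upper ones come from the matrix units themselves, lower ones from z times a matrix
  unit: where \<open>b\<close> crosses, division by z removes the factor.\<close>

lemma alg_at_subset_image:
  assumes "x \<in> alg_at n 0"
  shows "x \<in> iwahori_emb n ` iwahori n"
  using assms unfolding alg_at_def
proof (induction rule: tuple_alg.induct)
  case (diag i)
  have "(mat_unit n i i :: complex fps mat) \<in> iwahori n"
    by (rule iwahoriI) (auto simp: mat_unit_def)
  moreover have "iwahori_emb n (mat_unit n i i) = (\<lambda>b\<in>{..<n}. mat_unit n i i)"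
    by (rule iwahori_emb_restrictI, rule eq_matI)
      (use diag in \<open>auto simp: iwahori_emb_def mat_unit_def crosses_def\<close>)
  ultimately show ?case by force
next
  case (upper i j)
  have "(mat_unit n i j :: complex fps mat) \<in> iwahori n"
    by (rule iwahoriI) (use upper in \<open>auto simp: mat_unit_def\<close>)
  moreover have "iwahori_emb n (mat_unit n i j) = (\<lambda>b\<in>{..<n}. if crosses b i j
      then (fps_X + fps_const 0) \<cdot>\<^sub>m mat_unit n i j else mat_unit n i j)"
    by (rule iwahori_emb_restrictI, rule eq_matI)
      (use upper in \<open>auto simp: iwahori_emb_def mat_unit_def crosses_def\<close>)
  ultimately show ?case by force
next
  case (lower i j)
  have sh: "fps_shift 1 (fps_X :: complex fps) = 1"
    by (rule fps_ext) (simp add: fps_X_def)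
  have "(fps_X \<cdot>\<^sub>m mat_unit n j i :: complex fps mat) \<in> iwahori n"
    by (rule iwahoriI) (use lower in \<open>auto simp: mat_unit_def\<close>)
  moreover have "iwahori_emb n (fps_X \<cdot>\<^sub>m mat_unit n j i) = (\<lambda>b\<in>{..<n}. if crosses b i j
      then mat_unit n j i else (fps_X + fps_const 0) \<cdot>\<^sub>m mat_unit n j i)"
    by (rule iwahori_emb_restrictI, rule eq_matI)
      (use lower sh in \<open>auto simp: iwahori_emb_def mat_unit_def crosses_def\<close>)
  ultimately show ?case by force
next
  case (add x y)
  then obtain A B where "A \<in> iwahori n" "x = iwahori_emb n A" "B \<in> iwahori n" "y = iwahori_emb n B"
    by (elim imageE)
  then show ?case by (simp only: iwahori_emb_add[symmetric] imageI iwahori_add)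
next
  case (scale x c)
  then obtain A where "A \<in> iwahori n" "x = iwahori_emb n A" by (elim imageE)
  then show ?case by (simp only: iwahori_emb_smult[symmetric] imageI iwahori_smult)
qed

text \<open>Each matrix position contributes a single multiple of one generator, with a coefficient
  independent of \<open>b\<close>.\<close>

lemma iwahori_emb_entry_in_alg:
  assumes A: "A \<in> iwahori n" and ij: "i < n" "j < n"
  shows "(\<lambda>b\<in>{..<n}. mat n n (\<lambda>p. if p = (i, j) then iwahori_emb n A b $$ (i, j) else 0)) \<in> alg_at n 0"
    (is "?x \<in> _")
proof -
  consider "i = j" | "i < j" | "j < i" by linarith
  then show ?thesis
  proof cases
    case 1
    have "?x = (\<lambda>b\<in>{..<n}. A $$ (i, i) \<cdot>\<^sub>m (\<lambda>b\<in>{..<n}. mat_unit n i i) b)"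
      by (rule restrict_ext, rule eq_matI)
        (use 1 ij in \<open>auto simp: iwahori_emb_def mat_unit_def crosses_def\<close>)
    then show ?thesis
      unfolding alg_at_def by (simp only:) (rule tuple_alg.scale[OF tuple_alg.diag[OF ij(1)]])
  next
    case 2
    have "?x = (\<lambda>b\<in>{..<n}. A $$ (i, j) \<cdot>\<^sub>m (\<lambda>b\<in>{..<n}. if crosses b i j
        then (fps_X + fps_const 0) \<cdot>\<^sub>m mat_unit n i j else mat_unit n i j) b)"
      by (rule restrict_ext, rule eq_matI)
        (use 2 ij in \<open>auto simp: iwahori_emb_def mat_unit_def crosses_def\<close>)
    then show ?thesis
      unfolding alg_at_def by (simp only:) (rule tuple_alg.scale[OF tuple_alg.upper[OF 2 ij(2)]])
  next
    case 3
    \<comment> \<open>Away from the crossings the lower generator carries a factor z, so its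
      coefficient has to be the entry divided by z.\<close>
    have X: "fps_shift 1 (A $$ (i, j)) * fps_X = A $$ (i, j)"
      using fps_X_times_shift[OF iwahoriD(2)[OF A ij(1) 3]] by (simp add: mult.commute)
    have "?x = (\<lambda>b\<in>{..<n}. fps_shift 1 (A $$ (i, j)) \<cdot>\<^sub>m (\<lambda>b\<in>{..<n}. if crosses b j i
        then mat_unit n i j else (fps_X + fps_const 0) \<cdot>\<^sub>m mat_unit n i j) b)"
      by (rule restrict_ext, rule eq_matI)
        (use 3 ij X in \<open>auto simp: iwahori_emb_def mat_unit_def crosses_def\<close>)
    then show ?thesis
      unfolding alg_at_def by (simp only:) (rule tuple_alg.scale[OF tuple_alg.lower[OF 3 ij(1)]])
  qed
qed

lemma image_subset_alg_at:
  assumes A: "A \<in> iwahori n" and n: "0 < n"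
  shows "iwahori_emb n A \<in> alg_at n 0"
proof -
  \<comment> \<open>The tuple truncated to the positions in \<open>S\<close>. Since
    \<open>tuple_alg\<close> has only binary sums, the positions are added one at a time.\<close>
  define R where "R S = (\<lambda>b\<in>{..<n}. mat n n (\<lambda>p. if p \<in> S then iwahori_emb n A b $$ p else 0))"
    for S :: "(nat \<times> nat) set"
  have "R S \<in> alg_at n 0" if "finite S" "S \<subseteq> {..<n} \<times> {..<n}" for S
    using that
  proof (induction S)
    case empty
    \<comment> \<open>\<open>tuple_alg\<close> has no clause for zero; the zero tuple is 0 times a
      diagonal generator, which exists since \<open>0 < n\<close>.\<close>
    have "R {} = (\<lambda>b\<in>{..<n}. 0 \<cdot>\<^sub>m (\<lambda>b\<in>{..<n}. mat_unit n 0 0) b)"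
      unfolding R_def by (rule restrict_ext, rule eq_matI) (auto simp: mat_unit_def)
    then show ?case
      unfolding alg_at_def by (simp only:) (rule tuple_alg.scale[OF tuple_alg.diag[OF n]])
  next
    case (insert p S)
    obtain i j where p: "p = (i, j)" by fastforce
    let ?x = "\<lambda>b\<in>{..<n}. mat n n (\<lambda>p. if p = (i, j) then iwahori_emb n A b $$ (i, j) else 0)"
    have "R (insert p S) = (\<lambda>b\<in>{..<n}. R S b + ?x b)"
      unfolding R_def by (rule restrict_ext, rule eq_matI) (use insert p in auto)
    also have "\<dots> \<in> alg_at n 0"
      unfolding alg_at_def
    proof (rule tuple_alg.add)
      show "?x \<in> tuple_alg n (\<lambda>c. c) (fps_X + fps_const 0)"
        using iwahori_emb_entry_in_alg[OF A, of i j] insert.prems p unfolding alg_at_def by blast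
      show "R S \<in> tuple_alg n (\<lambda>c. c) (fps_X + fps_const 0)"
        using insert.IH insert.prems unfolding alg_at_def by blast
    qed
    finally show ?case .
  qed
  from this[of "{..<n} \<times> {..<n}"] have "R ({..<n} \<times> {..<n}) \<in> alg_at n 0" by simp
  moreover have "iwahori_emb n A = R ({..<n} \<times> {..<n})"
    unfolding R_def
    by (rule iwahori_emb_restrictI, rule eq_matI) (auto simp: iwahori_emb_def)
  ultimately show ?thesis by simp
qed

lemma lie_iso_iwahori_emb:
  assumes "0 < n"
  shows "lie_iso n (iwahori n) (alg_at n 0) (iwahori_emb n)"
  unfolding lie_iso_def
proof (intro conjI)
  show "bij_betw (iwahori_emb n) (iwahori n) (alg_at n 0)"
    using iwahori_emb_inj[OF assms] alg_at_subset_image image_subset_alg_at[OF _ assms]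
    by (auto simp: bij_betw_def)
qed (auto simp: iwahori_emb_add iwahori_emb_smult iwahori_emb_lie_br)


subsection \<open>Tuples over \<open>\<O>[\<epsilon>]\<close>\<close>

lemma tuple_alg_carrier:
  assumes "x \<in> tuple_alg n \<iota> w" "b < n"
  shows "x b \<in> carrier_mat n n"
  using assms by (induction rule: tuple_alg.induct) (auto simp: mat_unit_def)

lemma tuple_coeff_carrier:
  assumes "x \<in> alg_formal n" "b < n"
  shows "tuple_coeff n x i b \<in> carrier_mat n n"
  using tuple_alg_carrier[of x] assms unfolding alg_formal_def tuple_coeff_def by auto

text \<open>Both algebras are instances of \<open>tuple_alg\<close>, and taking constant terms in
  epsilon sends \<open>[:fps_X, 1:]\<close> to z and \<open>[:c:]\<close> to \<open>c\<close>. A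
  derivation at 0 can therefore be replayed formally.\<close>

lemma alg_formal_lift:
  assumes "x \<in> alg_at n 0"
  shows "\<exists>y\<in>alg_formal n. tuple_coeff n y 0 = x"
  using assms unfolding alg_at_def
proof (induction rule: tuple_alg.induct)
  case (diag i)
  show ?case unfolding alg_formal_def
    by (rule bexI[OF _ tuple_alg.diag[OF diag]])
      (auto simp: tuple_coeff_def mat_unit_def fun_eq_iff)
next
  case (upper i j)
  show ?case unfolding alg_formal_def
    by (rule bexI[OF _ tuple_alg.upper[OF upper]])
      (auto simp: tuple_coeff_def mat_unit_def fun_eq_iff)
next
  case (lower i j)
  show ?case unfolding alg_formal_def
    by (rule bexI[OF _ tuple_alg.lower[OF lower]])
      (auto simp: tuple_coeff_def mat_unit_def fun_eq_iff)
next
  case (add x y)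
  then obtain X Y where X: "X \<in> alg_formal n" "tuple_coeff n X 0 = x"
    and Y: "Y \<in> alg_formal n" "tuple_coeff n Y 0 = y" by blast
  have "tuple_coeff n (\<lambda>b\<in>{..<n}. X b + Y b) 0 = (\<lambda>b\<in>{..<n}. x b + y b)"
    unfolding X(2)[symmetric] Y(2)[symmetric] tuple_coeff_def
  proof (rule restrict_ext)
    fix b assume "b \<in> {..<n}"
    then have "X b \<in> carrier_mat n n" "Y b \<in> carrier_mat n n" "b < n"
      using X(1) Y(1) tuple_alg_carrier unfolding alg_formal_def by auto
    then show "map_mat (\<lambda>q. coeff q 0) ((\<lambda>b\<in>{..<n}. X b + Y b) b) =
        (\<lambda>b\<in>{..<n}. map_mat (\<lambda>q. coeff q 0) (X b)) b + (\<lambda>b\<in>{..<n}. map_mat (\<lambda>q. coeff q 0) (Y b)) b"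
      by (intro eq_matI) auto
  qed
  then show ?case using X Y tuple_alg.add unfolding alg_formal_def by blast
next
  case (scale x c)
  then obtain X where X: "X \<in> alg_formal n" "tuple_coeff n X 0 = x" by blast
  have "tuple_coeff n (\<lambda>b\<in>{..<n}. [:c:] \<cdot>\<^sub>m X b) 0 = (\<lambda>b\<in>{..<n}. c \<cdot>\<^sub>m x b)"
    unfolding X(2)[symmetric] tuple_coeff_def
    by (rule restrict_ext, rule eq_matI) auto
  then show ?case using X tuple_alg.scale unfolding alg_formal_def by blast
qed

text \<open>Finitely many polynomial entries have a common degree bound. This is what makes the
  convolution with a formal tuple a polynomial.\<close>

lemma tuple_coeff_eventually_zero:
  assumes "x \<in> alg_formal n"
  shows "MOST i. \<forall>b<n. tuple_coeff n x i b = 0\<^sub>m n n"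
proof -
  have "MOST i. \<forall>b\<in>{..<n}. \<forall>k\<in>{..<n}. \<forall>l\<in>{..<n}. coeff (x b $$ (k, l)) i = 0"
    by (intro eventually_ball_finite ballI finite_lessThan MOST_coeff_eq_0)
  then show ?thesis
  proof eventually_elim
    case (elim i)
    show ?case
    proof (intro allI impI eq_matI)
      fix b assume b: "b < n"
      note c = tuple_alg_carrier[OF assms[unfolded alg_formal_def] b]
      show "dim_row (tuple_coeff n x i b) = dim_row (0\<^sub>m n n)"
        "dim_col (tuple_coeff n x i b) = dim_col (0\<^sub>m n n)"
        using b c by (auto simp: tuple_coeff_def)
      fix k l assume "k < dim_row (0\<^sub>m n n :: complex fps mat)" "l < dim_col (0\<^sub>m n n :: complex fps mat)"
      then show "tuple_coeff n x i b $$ (k, l) = 0\<^sub>m n n $$ (k, l)"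
        using b c elim by (auto simp: tuple_coeff_def)
    qed
  qed
qed


subsection \<open>The action on the tensor product\<close>

lemma mat_tr_lie_br:
  assumes "A \<in> carrier_mat n n" "B \<in> carrier_mat n n"
  shows "mat_tr (lie_br A B) = 0"
proof -
  have "mat_tr (lie_br A B) =
      (\<Sum>i<n. \<Sum>k<n. A $$ (i, k) * B $$ (k, i)) - (\<Sum>i<n. \<Sum>k<n. B $$ (i, k) * A $$ (k, i))"
    using assms
    by (simp add: mat_tr_def lie_br_def mat_mult_entry[of A n B] mat_mult_entry[of B n A]
        sum_subtractf del: index_mult_mat(1))
  also have "(\<Sum>i<n. \<Sum>k<n. B $$ (i, k) * A $$ (k, i)) = (\<Sum>i<n. \<Sum>k<n. A $$ (i, k) * B $$ (k, i))"
    by (subst sum.swap) (simp add: mult.commute)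
  finally show ?thesis by simp
qed

text \<open>The projection along scalar matrices through which \<open>gl_ext\<close> acts. Being
  linear and compatible with brackets, it transfers the module laws from \<open>sl n\<close> to all
  matrices.\<close>

definition sl_part :: "nat \<Rightarrow> complex fps mat \<Rightarrow> complex fps mat" where
  "sl_part n A = A - (fps_const (1 / of_nat n) * mat_tr A) \<cdot>\<^sub>m 1\<^sub>m n"

lemma gl_ext_sl_part: "gl_ext n \<rho> A = \<rho> (sl_part n A)"
  by (simp add: gl_ext_def sl_part_def)

lemma sl_part_add:
  assumes "A \<in> carrier_mat n n" "B \<in> carrier_mat n n"
  shows "sl_part n (A + B) = sl_part n A + sl_part n B"
proof -
  have "mat_tr (A + B) = mat_tr A + mat_tr B"
    using assms by (simp add: mat_tr_def sum.distrib)
  then show ?thesis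
    by (intro eq_matI) (use assms in \<open>auto simp: sl_part_def algebra_simps\<close>)
qed

lemma sl_part_smult:
  assumes "A \<in> carrier_mat n n"
  shows "sl_part n (c \<cdot>\<^sub>m A) = c \<cdot>\<^sub>m sl_part n A"
proof -
  have "mat_tr (c \<cdot>\<^sub>m A) = c * mat_tr A"
    using assms by (simp add: mat_tr_def sum_distrib_left)
  then show ?thesis
    by (intro eq_matI) (use assms in \<open>auto simp: sl_part_def algebra_simps\<close>)
qed

text \<open>Scalar matrices are central: in the expanded product all terms but \<open>C * E\<close>
  are symmetric in the two factors and cancel in the commutator.\<close>

lemma lie_br_minus_scalar:
  assumes A: "A \<in> carrier_mat n n" and B: "B \<in> carrier_mat n n"
  shows "lie_br (A - a \<cdot>\<^sub>m 1\<^sub>m n) (B - b \<cdot>\<^sub>m 1\<^sub>m n) = lie_br A B"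
proof -
  have prod: "(C - c \<cdot>\<^sub>m 1\<^sub>m n) * (E - e \<cdot>\<^sub>m 1\<^sub>m n) = C * E - c \<cdot>\<^sub>m E - (e \<cdot>\<^sub>m C - (c * e) \<cdot>\<^sub>m 1\<^sub>m n)"
    if "C \<in> carrier_mat n n" "E \<in> carrier_mat n n" for C E and c e :: 'a
  proof -
    have 1: "c \<cdot>\<^sub>m 1\<^sub>m n \<in> carrier_mat n n" "e \<cdot>\<^sub>m 1\<^sub>m n \<in> carrier_mat n n" by auto
    have "(C - c \<cdot>\<^sub>m 1\<^sub>m n) * (E - e \<cdot>\<^sub>m 1\<^sub>m n) =
        (C - c \<cdot>\<^sub>m 1\<^sub>m n) * E - (C - c \<cdot>\<^sub>m 1\<^sub>m n) * (e \<cdot>\<^sub>m 1\<^sub>m n)"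
      using that 1 by (intro mult_minus_distrib_mat) auto
    also have "(C - c \<cdot>\<^sub>m 1\<^sub>m n) * E = C * E - (c \<cdot>\<^sub>m 1\<^sub>m n) * E"
      using that 1 by (intro minus_mult_distrib_mat) auto
    also have "(C - c \<cdot>\<^sub>m 1\<^sub>m n) * (e \<cdot>\<^sub>m 1\<^sub>m n) = C * (e \<cdot>\<^sub>m 1\<^sub>m n) - (c \<cdot>\<^sub>m 1\<^sub>m n) * (e \<cdot>\<^sub>m 1\<^sub>m n)"
      using that 1 by (intro minus_mult_distrib_mat) auto
    also have "(c \<cdot>\<^sub>m 1\<^sub>m n) * E = c \<cdot>\<^sub>m E"
      using that by (subst mult_smult_assoc_mat[where n = n]) auto
    also have "C * (e \<cdot>\<^sub>m 1\<^sub>m n) = e \<cdot>\<^sub>m C"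
      using that by (subst mult_smult_distrib[where n = n]) auto
    also have "(c \<cdot>\<^sub>m 1\<^sub>m n) * (e \<cdot>\<^sub>m 1\<^sub>m n) = (c * e) \<cdot>\<^sub>m 1\<^sub>m n"
      by (subst mult_smult_assoc_mat[where n = n]) (auto intro!: eq_matI)
    finally show ?thesis .
  qed
  have AB: "A * B \<in> carrier_mat n n" "B * A \<in> carrier_mat n n" using A B by auto
  show ?thesis
    unfolding lie_br_def prod[OF A B] prod[OF B A]
    by (rule eq_matI) (use A B AB in \<open>auto simp: algebra_simps simp del: index_mult_mat(1)\<close>)
qed

text \<open>A commutator has trace 0, so the left side is the bracket itself; on the right the
  scalar corrections drop out.\<close>

lemma sl_part_lie_br:
  assumes "A \<in> carrier_mat n n" "B \<in> carrier_mat n n"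
  shows "sl_part n (lie_br A B) = lie_br (sl_part n A) (sl_part n B)"
proof -
  have "lie_br A B \<in> carrier_mat n n" using assms by (auto simp: lie_br_def)
  then have "sl_part n (lie_br A B) = lie_br A B"
    by (intro eq_matI) (auto simp: sl_part_def mat_tr_lie_br[OF assms])
  then show ?thesis using lie_br_minus_scalar[OF assms] by (simp add: sl_part_def)
qed

section \<open>Linearity in the tensor and reduction to pure tensors\<close>

lemma pure_tensor_upd_add:
  assumes "d \<in> Pi\<^sub>E {..<n} D" "b < n" "u \<in> D b" "w \<in> D b"
  shows "pure_tensor n s D (d(b := u + w)) = pure_tensor n s D (d(b := u)) + pure_tensor n s D (d(b := w))"
  using multilinear_pure_tensor[of n s D] assms unfolding multilinear_on_def by blast

lemma pure_tensor_upd_scale: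
  assumes "d \<in> Pi\<^sub>E {..<n} D" "b < n" "u \<in> D b"
  shows "pure_tensor n s D (d(b := s c u)) = tensor_scale c (pure_tensor n s D (d(b := u)))"
  using multilinear_pure_tensor[of n s D] assms unfolding multilinear_on_def by blast

text \<open>A transpose is linear in its argument, here on the whole space of functionals.\<close>

lemma tensor_act_plus: "tensor_act n s D \<rho> x (t + u) = tensor_act n s D \<rho> x t + tensor_act n s D \<rho> x u"
  by (auto simp: tensor_act_def fun_eq_iff)

lemma tensor_act_scale: "tensor_act n s D \<rho> x (tensor_scale c t) = tensor_scale c (tensor_act n s D \<rho> x t)"
  by (auto simp: tensor_act_def tensor_scale_def fun_eq_iff)

lemma tensor_act_0: "tensor_act n s D \<rho> x 0 = 0"
  by (auto simp: tensor_act_def fun_eq_iff)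

lemma tensor_act_sum: "tensor_act n s D \<rho> x (\<Sum>i\<in>I. t i) = (\<Sum>i\<in>I. tensor_act n s D \<rho> x (t i))"
  by (induction I rule: infinite_finite_induct) (simp_all only: sum.infinite sum.empty sum.insert
      tensor_act_0 tensor_act_plus not_False_eq_True)

text \<open>From here on tensors are handled as vectors, not evaluated pointwise by simp.\<close>

declare zero_fun_apply [simp del] plus_fun_apply [simp del] minus_apply [simp del]

interpretation tensor: vector_space "tensor_scale :: complex \<Rightarrow> 'v tensor \<Rightarrow> 'v tensor"
  by (rule vector_space_tensor)

lemma tensor_subspace: "tensor.subspace (tensor_space n s D)"
  by (simp add: tensor_space_def tensor.subspace_span)

lemma pure_in_tensor_space: "d \<in> Pi\<^sub>E {..<n} D \<Longrightarrow> pure_tensor n s D d \<in> tensor_space n s D"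
  by (auto simp: tensor_space_def intro: tensor.span_base)

text \<open>The identities for the action are linear in the tensor; this rule reduces them to pure
  tensors, where the action is explicit.\<close>

lemma tensor_space_induct [consumes 1, case_names zero step]:
  assumes "t \<in> tensor_space n s D" "P 0"
    and "\<And>c d u. d \<in> Pi\<^sub>E {..<n} D \<Longrightarrow> P u \<Longrightarrow> P (tensor_scale c (pure_tensor n s D d) + u)"
  shows "P t"
  using assms(1) unfolding tensor_space_def
  by (induction rule: tensor.span_induct_alt) (use assms(2,3) in auto)

section \<open>The tensor product as a module over tuples of matrices\<close>

locale tensor_modules = vector_space s
  for s :: "complex \<Rightarrow> 'v::ab_group_add \<Rightarrow> 'v" +
  fixes n :: nat and D :: "nat \<Rightarrow> 'v set" and \<rho> :: "nat \<Rightarrow> complex fps mat \<Rightarrow> 'v \<Rightarrow> 'v"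
  assumes n_pos: "0 < n"
    and sl_module: "\<And>b. b < n \<Longrightarrow> lie_module (sl n) s (D b) (\<rho> b)"
begin

abbreviation "T \<equiv> tensor_space n s D"
abbreviation "act \<equiv> tensor_act n s D \<rho>"
abbreviation "pt \<equiv> pure_tensor n s D"
abbreviation "gl b \<equiv> gl_ext n (\<rho> b)"

lemma sl_part_sl: "A \<in> carrier_mat n n \<Longrightarrow> sl_part n A \<in> sl n"
  using gl_ext_sl[OF _ n_pos] by (simp add: sl_part_def)

lemma gl_closed: "b < n \<Longrightarrow> A \<in> carrier_mat n n \<Longrightarrow> u \<in> D b \<Longrightarrow> gl b A u \<in> D b"
  using sl_module[of b] sl_part_sl[of A] unfolding gl_ext_sl_part lie_module_def by simp

lemma gl_add: "b < n \<Longrightarrow> A \<in> carrier_mat n n \<Longrightarrow> B \<in> carrier_mat n n \<Longrightarrow> u \<in> D b \<Longrightarrow>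
    gl b (A + B) u = gl b A u + gl b B u"
  using sl_module[of b] sl_part_sl unfolding gl_ext_sl_part lie_module_def by (simp add: sl_part_add)

lemma gl_smult: "b < n \<Longrightarrow> A \<in> carrier_mat n n \<Longrightarrow> u \<in> D b \<Longrightarrow>
    gl b (fps_const c \<cdot>\<^sub>m A) u = s c (gl b A u)"
  using sl_module[of b] sl_part_sl unfolding gl_ext_sl_part lie_module_def by (simp add: sl_part_smult)

lemma gl_lie_br: "b < n \<Longrightarrow> A \<in> carrier_mat n n \<Longrightarrow> B \<in> carrier_mat n n \<Longrightarrow> u \<in> D b \<Longrightarrow>
    gl b (lie_br A B) u = gl b A (gl b B u) - gl b B (gl b A u)"
  using sl_module[of b] sl_part_sl unfolding gl_ext_sl_part lie_module_def by (simp add: sl_part_lie_br)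

lemma upd_closed: "d \<in> Pi\<^sub>E {..<n} D \<Longrightarrow> b < n \<Longrightarrow> u \<in> D b \<Longrightarrow> d(b := u) \<in> Pi\<^sub>E {..<n} D"
  by (auto simp: PiE_iff extensional_def)

lemma comp_in: "d \<in> Pi\<^sub>E {..<n} D \<Longrightarrow> b < n \<Longrightarrow> d b \<in> D b"
  by (auto simp: PiE_iff)

lemma act_pure:
  assumes "\<And>b. b < n \<Longrightarrow> x b \<in> carrier_mat n n" "d \<in> Pi\<^sub>E {..<n} D"
  shows "act x (pt d) = (\<Sum>b<n. pt (d(b := gl b (x b) (d b))))"
  by (rule tensor_act_pure) (use assms n_pos sl_module vector_space_axioms in auto)

lemma act_closed:
  assumes x: "\<And>b. b < n \<Longrightarrow> x b \<in> carrier_mat n n" and t: "t \<in> T"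
  shows "act x t \<in> T"
  using t
proof (induction rule: tensor_space_induct)
  case zero
  show ?case by (simp add: tensor_act_0 tensor.subspace_0[OF tensor_subspace])
next
  case (step c d u)
  have "(\<Sum>b<n. pt (d(b := gl b (x b) (d b)))) \<in> T"
    by (intro tensor.subspace_sum[OF tensor_subspace] pure_in_tensor_space upd_closed gl_closed
        comp_in step x) auto
  then have "act x (pt d) \<in> T" by (simp add: act_pure x step(1))
  then show ?case
    using step(2) unfolding tensor_act_plus tensor_act_scale
    by (intro tensor.subspace_add[OF tensor_subspace] tensor.subspace_scale[OF tensor_subspace])
qed

lemma act_add:
  assumes x: "\<And>b. b < n \<Longrightarrow> x b \<in> carrier_mat n n" and y: "\<And>b. b < n \<Longrightarrow> y b \<in> carrier_mat n n"
    and t: "t \<in> T"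
  shows "act (\<lambda>b\<in>{..<n}. x b + y b) t = act x t + act y t"
  using t
proof (induction rule: tensor_space_induct)
  case zero
  show ?case by (simp add: tensor_act_0)
next
  case (step c d u)
  have "act (\<lambda>b\<in>{..<n}. x b + y b) (pt d) = act x (pt d) + act y (pt d)"
    using step(1) x y
    by (simp add: act_pure gl_add comp_in pure_tensor_upd_add gl_closed flip: sum.distrib)
  then show ?case
    by (simp only: tensor_act_plus tensor_act_scale step tensor.scale_right_distrib ac_simps)
qed

lemma act_smult:
  assumes x: "\<And>b. b < n \<Longrightarrow> x b \<in> carrier_mat n n" and t: "t \<in> T"
  shows "act (\<lambda>b\<in>{..<n}. fps_const a \<cdot>\<^sub>m x b) t = tensor_scale a (act x t)"
  using t
proof (induction rule: tensor_space_induct)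
  case zero
  show ?case by (simp add: tensor_act_0)
next
  case (step c d u)
  have "act (\<lambda>b\<in>{..<n}. fps_const a \<cdot>\<^sub>m x b) (pt d) = tensor_scale a (act x (pt d))"
    using step(1) x
    by (simp add: act_pure gl_smult comp_in pure_tensor_upd_scale gl_closed tensor.scale_sum_right)
  then show ?case
    by (simp only: tensor_act_plus tensor_act_scale step tensor.scale_right_distrib
        tensor.scale_left_commute)
qed

lemma act_zero:
  assumes x: "\<And>b. b < n \<Longrightarrow> x b = 0\<^sub>m n n" and t: "t \<in> T"
  shows "act x t = 0"
proof -
  \<comment> \<open>The zero tuple equals 0 times itself, and only components below \<open>n\<close>
    matter.\<close>
  have "act x t = act (\<lambda>b\<in>{..<n}. fps_const 0 \<cdot>\<^sub>m x b) t"
    using x by (auto simp: tensor_act_def fun_eq_iff intro!: arg_cong[where f = t])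
  also have "\<dots> = 0" using x by (subst act_smult[OF _ t]) auto
  finally show ?thesis .
qed

lemma pure_upd_diff:
  assumes "d \<in> Pi\<^sub>E {..<n} D" "b < n" "u \<in> D b" "w \<in> D b"
  shows "pt (d(b := u - w)) = pt (d(b := u)) - pt (d(b := w))"
proof -
  have "u - w \<in> D b"
    using sl_module[OF assms(2)] assms(3,4) unfolding lie_module_def by (blast intro: subspace_diff)
  then show ?thesis using pure_tensor_upd_add[OF assms(1,2), of "u - w" w s] assms by simp
qed

text \<open>Operators on different factors commute, so the commutator keeps only the terms where
  both act on the same factor, and these give the bracket there.\<close>

lemma act_lie_br:
  assumes x: "\<And>b. b < n \<Longrightarrow> x b \<in> carrier_mat n n" and y: "\<And>b. b < n \<Longrightarrow> y b \<in> carrier_mat n n"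
    and t: "t \<in> T"
  shows "act (\<lambda>b\<in>{..<n}. lie_br (x b) (y b)) t = act x (act y t) - act y (act x t)"
  using t
proof (induction rule: tensor_space_induct)
  case zero
  show ?case by (simp add: tensor_act_0)
next
  case (step c d u)
  note d = step(1)
  \<comment> \<open>\<open>y\<close> acts first, on factor \<open>b\<close>; then \<open>x\<close>
    acts on factor \<open>c\<close> of the result, which may be the same factor.\<close>
  define P where "P x y b c = (let e = d(b := gl b (y b) (d b)) in pt (e(c := gl c (x c) (e c))))"
    for x y b c
  have twice: "act x (act y (pt d)) = (\<Sum>b<n. \<Sum>c<n. P x y b c)"
    if x: "\<And>b. b < n \<Longrightarrow> x b \<in> carrier_mat n n" and y: "\<And>b. b < n \<Longrightarrow> y b \<in> carrier_mat n n" for x y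
  proof -
    have "act x (act y (pt d)) = (\<Sum>b<n. act x (pt (d(b := gl b (y b) (d b)))))"
      by (simp add: act_pure y d tensor_act_sum)
    also have "\<dots> = (\<Sum>b<n. \<Sum>c<n. P x y b c)"
      unfolding P_def Let_def
    proof (rule sum.cong[OF refl])
      fix b assume "b \<in> {..<n}"
      then have "d(b := gl b (y b) (d b)) \<in> Pi\<^sub>E {..<n} D"
        by (intro upd_closed gl_closed comp_in d y) auto
      then show "act x (pt (d(b := gl b (y b) (d b)))) = (\<Sum>c<n. pt ((d(b := gl b (y b) (d b)))
          (c := gl c (x c) ((d(b := gl b (y b) (d b))) c))))"
        by (intro act_pure x)
    qed
    finally show ?thesis .
  qed
  have xy: "act x (act y (pt d)) = (\<Sum>b<n. \<Sum>c<n. P x y b c)" by (intro twice x y)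
  have yx: "act y (act x (pt d)) = (\<Sum>b<n. \<Sum>c<n. P y x b c)" by (intro twice x y)
  have offdiag: "P x y b c = P y x c b" if "b \<noteq> c" for b c
    using that by (auto simp: P_def Let_def fun_upd_twist)
  \<comment> \<open>The second double sum is transposed so that each term meets its partner from
    \<open>offdiag\<close>.\<close>
  have "act x (act y (pt d)) - act y (act x (pt d)) = (\<Sum>b<n. \<Sum>c<n. P x y b c - P y x c b)"
    unfolding xy yx sum_subtractf by (rule arg_cong2[where f = minus, OF refl sum.swap])
  also have "\<dots> = (\<Sum>b<n. \<Sum>c<n. if b = c then P x y b b - P y x b b else 0)"
    by (intro sum.cong refl) (auto simp: offdiag)
  also have "\<dots> = (\<Sum>b<n. P x y b b - P y x b b)" by simp
  also have "\<dots> = act (\<lambda>b\<in>{..<n}. lie_br (x b) (y b)) (pt d)"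
  proof -
    have "lie_br (x b) (y b) \<in> carrier_mat n n" if "b < n" for b
      using x[OF that] y[OF that] by (auto simp: lie_br_def)
    then show ?thesis
      using x y d
      by (simp add: act_pure P_def Let_def gl_lie_br comp_in pure_upd_diff gl_closed)
  qed
  finally have "act (\<lambda>b\<in>{..<n}. lie_br (x b) (y b)) (pt d) = act x (act y (pt d)) - act y (act x (pt d))"
    by (rule sym)
  then show ?case
    by (simp only: tensor_act_plus tensor_act_scale step(2) tensor.scale_right_diff_distrib add_diff_add)
qed


subsection \<open>Convolution and the limit\<close>

text \<open>\<open>conv\<close> is built with \<open>Abs_poly\<close>, so its coefficients can be
  read off only once almost all of them are known to vanish.\<close>

lemma coeff_conv_act:
  assumes x: "x \<in> alg_formal n" and p: "\<And>k. coeff p k \<in> T"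
  shows "coeff (conv act (tuple_coeff n x) p) k = (\<Sum>i\<le>k. act (tuple_coeff n x i) (coeff p (k - i)))"
proof -
  obtain N where N: "\<And>i b. i > N \<Longrightarrow> b < n \<Longrightarrow> tuple_coeff n x i b = 0\<^sub>m n n"
    using tuple_coeff_eventually_zero[OF x] by (auto simp: MOST_nat)
  \<comment> \<open>Beyond \<open>N + degree p\<close>, each summand has \<open>i > N\<close> or
    \<open>k - i > degree p\<close>, so the tuple or the tensor is zero.\<close>
  have "(\<Sum>i\<le>k. act (tuple_coeff n x i) (coeff p (k - i))) = 0" if k: "k > N + degree p" for k
  proof (rule sum.neutral, rule ballI)
    fix i assume "i \<in> {..k}"
    show "act (tuple_coeff n x i) (coeff p (k - i)) = 0"
    proof (cases "i > N")
      case True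
      then show ?thesis using N p by (intro act_zero) auto
    next
      case False
      with k have "coeff p (k - i) = 0" by (intro coeff_eq_0) auto
      then show ?thesis by (simp add: tensor_act_0)
    qed
  qed
  then have "MOST k. (\<Sum>i\<le>k. act (tuple_coeff n x i) (coeff p (k - i))) = 0"
    unfolding MOST_nat by blast
  then show ?thesis by (simp add: conv_def Abs_poly_inverse)
qed

lemma coeff_conv_scale:
  "coeff (conv tensor_scale (coeff c) p) k = (\<Sum>i\<le>k. tensor_scale (coeff c i) (coeff p (k - i)))"
proof -
  have "(\<Sum>i\<le>k. tensor_scale (coeff c i) (coeff p (k - i))) = 0" if "k > degree c + degree p" for k
  proof (rule sum.neutral, rule ballI)
    fix i assume "i \<in> {..k}"
    with that have "coeff c i = 0 \<or> coeff p (k - i) = 0"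
      using coeff_eq_0[of c i] coeff_eq_0[of p "k - i"] by linarith
    then show "tensor_scale (coeff c i) (coeff p (k - i)) = 0" by auto
  qed
  then have "MOST k. (\<Sum>i\<le>k. tensor_scale (coeff c i) (coeff p (k - i))) = 0"
    unfolding MOST_nat by blast
  then show ?thesis by (simp add: conv_def Abs_poly_inverse)
qed

section \<open>Convolution and multiplication by powers of epsilon\<close>

lemma conv_act_closed:
  assumes x: "x \<in> alg_formal n" and p: "\<And>k. coeff p k \<in> T"
  shows "coeff (conv act (tuple_coeff n x) p) k \<in> T"
  unfolding coeff_conv_act[OF assms]
  by (intro tensor.subspace_sum[OF tensor_subspace] act_closed tuple_coeff_carrier[OF x] p)

lemma conv_act_pCons:
  assumes x: "x \<in> alg_formal n" and p: "\<And>k. coeff p k \<in> T"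
  shows "conv act (tuple_coeff n x) (pCons 0 p) = pCons 0 (conv act (tuple_coeff n x) p)"
proof (rule poly_eqI)
  fix k
  have p': "coeff (pCons 0 p) k \<in> T" for k
    by (cases k) (auto simp: p tensor.subspace_0[OF tensor_subspace])
  show "coeff (conv act (tuple_coeff n x) (pCons 0 p)) k = coeff (pCons 0 (conv act (tuple_coeff n x) p)) k"
    \<comment> \<open>For \<open>k > 0\<close> the left side has one more summand,
      \<open>i = k\<close>, which meets the constant coefficient 0.\<close>
    unfolding coeff_conv_act[OF x p']
    by (cases k) (auto simp: coeff_conv_act[OF x p] tensor_act_0 Suc_diff_le intro!: sum.cong)
qed

lemma pCons_power_closed:
  assumes "\<And>k. coeff p k \<in> T"
  shows "coeff ((pCons 0 ^^ r) p) k \<in> T"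
proof (induction r arbitrary: k)
  case (Suc r)
  then show ?case by (cases k) (auto simp: tensor.subspace_0[OF tensor_subspace])
qed (use assms in simp)

lemma conv_act_pCons_power:
  assumes x: "x \<in> alg_formal n" and p: "\<And>k. coeff p k \<in> T"
  shows "conv act (tuple_coeff n x) ((pCons 0 ^^ r) p) = (pCons 0 ^^ r) (conv act (tuple_coeff n x) p)"
  by (induction r) (simp_all add: conv_act_pCons[OF x pCons_power_closed] p)

text \<open>Shows that the \<open>scale\<close> clause of \<open>formal_module\<close> includes
  multiplication by epsilon.\<close>

lemma conv_scale_monom: "conv tensor_scale (coeff [:0, 1:]) p = pCons 0 p"
proof (rule poly_eqI)
  fix k
  have "(\<Sum>i\<le>Suc m. tensor_scale (coeff [:0, 1:] i) (coeff p (Suc m - i))) = coeff p m" for m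
  proof -
    have "(\<Sum>i\<le>Suc m. tensor_scale (coeff [:0, 1:] i) (coeff p (Suc m - i))) =
        (\<Sum>i\<le>Suc m. if i = 1 then coeff p m else 0)"
      by (intro sum.cong refl) (auto simp: coeff_pCons split: nat.split)
    then show ?thesis by simp
  qed
  then show "coeff (conv tensor_scale (coeff [:0, 1:]) p) k = coeff (pCons 0 p) k"
    unfolding coeff_conv_scale by (cases k) auto
qed

lemma coeff_conv_scale_const: "coeff (conv tensor_scale (coeff [:a:]) p) k = tensor_scale a (coeff p k)"
proof -
  have "(\<Sum>i\<le>k. tensor_scale (coeff [:a:] i) (coeff p (k - i))) =
      (\<Sum>i\<le>k. if i = 0 then tensor_scale a (coeff p k) else 0)"
    by (intro sum.cong refl) (auto simp: coeff_pCons split: nat.split)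
  then show ?thesis unfolding coeff_conv_scale by simp
qed

lemma conv_scale_const_pCons_power:
  "conv tensor_scale (coeff [:a:]) ((pCons 0 ^^ r) p) = (pCons 0 ^^ r) (conv tensor_scale (coeff [:a:]) p)"
  for p :: "'v tensor poly"
proof (induction r)
  case (Suc r)
  have "conv tensor_scale (coeff [:a:]) (pCons 0 q) = pCons 0 (conv tensor_scale (coeff [:a:]) q)"
    for q :: "'v tensor poly"
  proof (rule poly_eqI)
    fix k
    show "coeff (conv tensor_scale (coeff [:a:]) (pCons 0 q)) k =
        coeff (pCons 0 (conv tensor_scale (coeff [:a:]) q)) k"
      by (cases k) (simp_all only: coeff_conv_scale_const coeff_pCons_0 coeff_pCons_Suc
          tensor.scale_zero_right)
  qed
  with Suc show ?case by simp
qed simp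

lemma pCons_power_add:
  "(pCons 0 ^^ r) (p + q) = (pCons 0 ^^ r) p + (pCons 0 ^^ r) (q :: 'v tensor poly)"
  by (induction r) (simp_all add: add_pCons)

section \<open>The limit as a module over the Iwahori algebra\<close>

abbreviation "M v \<equiv> formal_module n s D \<rho> v"
abbreviation "L v \<equiv> limit_module n s D \<rho> v"

lemma formal_pCons_power: "p \<in> M v \<Longrightarrow> (pCons 0 ^^ r) p \<in> M v"
proof (induction r)
  case (Suc r)
  then show ?case using formal_module.scale[of _ n s D \<rho> v "[:0, 1:]"] by (simp add: conv_scale_monom)
qed simp

lemma limitI: "(\<And>k. coeff q k \<in> T) \<Longrightarrow> (pCons 0 ^^ r) q \<in> M v \<Longrightarrow> coeff q 0 \<in> L v"
  unfolding limit_module_def by blast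

lemma limitE:
  assumes "t \<in> L v"
  obtains q r where "t = coeff q 0" "\<And>k. coeff q k \<in> T" "(pCons 0 ^^ r) q \<in> M v"
  using assms unfolding limit_module_def by blast

lemma limit_subset: "L v \<subseteq> T"
  by (auto elim: limitE)

lemma limit_stable:
  assumes x: "x \<in> alg_at n 0" and t: "t \<in> L v"
  shows "act x t \<in> L v"
proof -
  obtain X where X: "X \<in> alg_formal n" "tuple_coeff n X 0 = x"
    using alg_formal_lift[OF x] by blast
  obtain q r where q: "t = coeff q 0" "\<And>k. coeff q k \<in> T" "(pCons 0 ^^ r) q \<in> M v"
    using limitE[OF t] by metis
  \<comment> \<open>The same exponent \<open>r\<close> serves for the image, since the action
    commutes with epsilon.\<close>
  have "(pCons 0 ^^ r) (conv act (tuple_coeff n X) q) \<in> M v"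
    using formal_module.act[OF X(1) q(3)] conv_act_pCons_power[OF X(1) q(2)] by simp
  then have "coeff (conv act (tuple_coeff n X) q) 0 \<in> L v"
    by (intro limitI conv_act_closed X q)
  \<comment> \<open>At \<open>k = 0\<close> the convolution has the single term
    \<open>i = 0\<close>, which is \<open>x\<close> acting on \<open>t\<close>.\<close>
  then show ?thesis using X q by (simp add: coeff_conv_act)
qed

lemma limit_subspace: "tensor.subspace (L v)"
  unfolding tensor.subspace_def
proof (intro conjI ballI allI)
  \<comment> \<open>\<open>formal_module\<close> has no zero clause, so 0 arises by scaling the
    generator with the zero polynomial.\<close>
  have "conv tensor_scale (coeff [:0:]) [:pt (restrict v {..<n}):] \<in> M v"
    by (intro formal_module.scale formal_module.base)
  moreover have "conv tensor_scale (coeff [:0:]) [:pt (restrict v {..<n}):] = 0"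
    by (rule poly_eqI) (simp only: coeff_conv_scale_const tensor.scale_zero_left coeff_0)
  ultimately have "(pCons 0 ^^ 0) 0 \<in> M v" by simp
  then show "0 \<in> L v"
    using limitI[of 0 0 v] by (simp add: tensor.subspace_0[OF tensor_subspace])
next
  fix t u assume "t \<in> L v" "u \<in> L v"
  then obtain p r q l where p: "t = coeff p 0" "\<And>k. coeff p k \<in> T" "(pCons 0 ^^ r) p \<in> M v"
    and q: "u = coeff q 0" "\<And>k. coeff q k \<in> T" "(pCons 0 ^^ l) q \<in> M v"
    using limitE by metis
  \<comment> \<open>The exponents may differ; \<open>r + l\<close> serves both, each summand
    receiving the missing power of epsilon.\<close>
  have "(pCons 0 ^^ (r + l)) (p + q) = (pCons 0 ^^ l) ((pCons 0 ^^ r) p) + (pCons 0 ^^ r) ((pCons 0 ^^ l) q)"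
    unfolding pCons_power_add by (simp add: funpow_add[symmetric, THEN fun_cong, simplified] add.commute)
  also have "\<dots> \<in> M v" by (intro formal_module.add formal_pCons_power p q)
  finally have "coeff (p + q) 0 \<in> L v"
    by (rule limitI[rotated]) (simp only: coeff_add tensor.subspace_add[OF tensor_subspace] p q)
  then show "t + u \<in> L v" using p q by simp
next
  fix a t assume "t \<in> L v"
  then obtain q r where q: "t = coeff q 0" "\<And>k. coeff q k \<in> T" "(pCons 0 ^^ r) q \<in> M v"
    using limitE by metis
  have "coeff (conv tensor_scale (coeff [:a:]) q) 0 \<in> L v"
  proof (rule limitI)
    show "(pCons 0 ^^ r) (conv tensor_scale (coeff [:a:]) q) \<in> M v"
      unfolding conv_scale_const_pCons_power[symmetric] by (rule formal_module.scale[OF q(3)])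
  qed (simp only: coeff_conv_scale_const tensor.subspace_scale[OF tensor_subspace] q)
  then show "tensor_scale a t \<in> L v" using q by (simp only: coeff_conv_scale_const)
qed

text \<open>The action is pulled back along \<open>iwahori_emb n\<close>. The laws of
  \<open>act\<close> hold on \<open>T\<close>, hence on the limit inside it, and
  \<open>limit_stable\<close> gives closure.\<close>

lemma lie_module_limit:
  "lie_module (iwahori n) tensor_scale (L v) (\<lambda>A. act (iwahori_emb n A))"
proof -
  have inT: "t \<in> T" if "t \<in> L v" for t using limit_subset that by blast
  show ?thesis
    unfolding lie_module_def
    by (auto simp: tensor_act_plus tensor_act_scale limit_subspace iwahori_emb_add iwahori_emb_smult
        iwahori_emb_lie_br act_add act_smult act_lie_br iwahori_emb_carrier inT
        intro!: limit_stable image_subset_alg_at n_pos)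
qed

end

theorem lemma5p8:
  fixes n :: nat
    and s :: "complex \<Rightarrow> 'v::ab_group_add \<Rightarrow> 'v"
    and D :: "nat \<Rightarrow> 'v set"
    and \<rho> :: "nat \<Rightarrow> complex fps mat \<Rightarrow> 'v \<Rightarrow> 'v"
    and v :: "nat \<Rightarrow> 'v"
  assumes "n \<ge> 2"
    and "vector_space s"
    and "\<And>b. b < n \<Longrightarrow> cyclic_graded_module n s (D b) (\<rho> b) (v b)"
    and "\<And>b. 1 \<le> b \<Longrightarrow> b < n \<Longrightarrow> admissible n b s (D b) (\<rho> b) (v b)"
  shows "limit_module n s D \<rho> v \<subseteq> tensor_space n s D
    \<and> (\<forall>x\<in>alg_at n 0. \<forall>t\<in>limit_module n s D \<rho> v.
          tensor_act n s D \<rho> x t \<in> limit_module n s D \<rho> v)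
    \<and> (\<exists>\<phi>. lie_iso n (iwahori n) (alg_at n 0) \<phi>
          \<and> lie_module (iwahori n) tensor_scale (limit_module n s D \<rho> v)
               (\<lambda>A. tensor_act n s D \<rho> (\<phi> A)))"
proof -
  interpret vector_space s by fact
  interpret tensor_modules s n D \<rho>
    by standard (use assms(1,3) in \<open>auto simp: cyclic_graded_module_def\<close>)
  \<comment> \<open>The isomorphism is \<open>iwahori_emb n\<close>, the map along which the action
    was pulled back.\<close>
  show ?thesis
    using limit_subset limit_stable lie_iso_iwahori_emb[OF n_pos] lie_module_limit by blast
qed

end
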